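(* Let $C$ be a 3-rotationally symmetric planar convex body, and let $T_b$ be its associated standard trisection. Then $$d_M(T_b,C)\leq d_M(T,C)$$ for any trisection $T$ of $C$.
   Context: A planar convex body is a compact convex subset of the Euclidean plane with nonempty interior; $d$ is the Euclidean distance. $C$ is 3-rotationally symmetric if there is a center $p\in C$ such that $C$ is invariant under the rotation of angle $120$ degrees about $p$. Trisection: a trisection $T$ of a planar compact set $C$ is a decomposition $\{C_1,C_2,C_3\}$ of $C$ into compact subsets by planar curves $\{\gamma_{12},\gamma_{23},\gamma_{13}\}$ such that: (i) $C=C_1\cup C_2\cup C_3$; (ii) $\operatorname{int}(C_i)\cap\operatorname{int}(C_j)=\emptyset$ for $i\neq j$; (iii) $\operatorname{area}(C_i)=\frac13\operatorname{area}(C)$ for each $i$; (iv) each $C_i$ is connected and $\gamma_{ij}=\partial C_i\cap\partial C_j$; (v) the three curves meet at a point $c\in\operatorname{int}(C)$ (the common point), and their other endpoints are (different) points of $\partial C$, called the endpoints of the trisection. Maximum relative diameter: $d_M(T,C)=\max\{D(C_1),D(C_2),D(C_3)\}$, where $D(C_i)=\max\{d(x,y):x,y\in C_i\}$. Standard trisection: let $T_r(C)$ be the smallest equilateral triangle containing $C$, constructed as follows: choose $m\in\partial C$ with $d(p,m)=d(p,\partial C)$ (any such $m$ if there are several), take the line through $m$ orthogonal to the segment $\overline{pm}$, and its images under the rotations of $120$ and $240$ degrees about $p$; these three lines bound $T_r(C)$. The midpoints $v_1,v_2,v_3$ of the edges of $T_r(C)$ lie on $\partial C$. The standard trisection $T_b=T_b(C)$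 is the trisection of $C$ given by the three line segments joining $p$ to $v_1,v_2,v_3$; its endpoints are $v_1,v_2,v_3$. *)

theory Defs
  imports "HOL-Analysis.Analysis"
begin

(* The Euclidean plane is the type complex, so that the rotation of angle 120 degrees about p
   is z |-> p + cis (2 * pi / 3) * (z - p). *)

definition planar_convex_body :: "complex set \<Rightarrow> bool" where
  "planar_convex_body C \<longleftrightarrow> compact C \<and> convex C \<and> interior C \<noteq> {}"

definition rot120 :: "complex \<Rightarrow> complex \<Rightarrow> complex" where
  "rot120 p z = p + cis (2 * pi / 3) * (z - p)"

definition rot240 :: "complex \<Rightarrow> complex \<Rightarrow> complex" where
  "rot240 p z = p + cis (4 * pi / 3) * (z - p)"

definition three_rot_symmetric_about :: "complex set \<Rightarrow> complex \<Rightarrow> bool" where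
  "three_rot_symmetric_about C p \<longleftrightarrow> p \<in> C \<and> rot120 p ` C = C"

record trisection =
  part1 :: "complex set"
  part2 :: "complex set"
  part3 :: "complex set"
  curve12 :: "real \<Rightarrow> complex"
  curve23 :: "real \<Rightarrow> complex"
  curve13 :: "real \<Rightarrow> complex"

(* The curves are continuous paths on [0, 1], oriented from the common point c towards the
   boundary of C; they are not required to be simple, nor to meet only at c. *)
definition is_trisection :: "complex set \<Rightarrow> trisection \<Rightarrow> bool" where
  "is_trisection C T \<longleftrightarrow>
     compact (part1 T) \<and> compact (part2 T) \<and> compact (part3 T) \<and>
     path (curve12 T) \<and> path (curve23 T) \<and> path (curve13 T) \<and>
     C = part1 T \<union> part2 T \<union> part3 T \<and>
     interior (part1 T) \<inter> interior (part2 T) = {} \<and>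
     interior (part2 T) \<inter> interior (part3 T) = {} \<and>
     interior (part1 T) \<inter> interior (part3 T) = {} \<and>
     measure lebesgue (part1 T) = measure lebesgue C / 3 \<and>
     measure lebesgue (part2 T) = measure lebesgue C / 3 \<and>
     measure lebesgue (part3 T) = measure lebesgue C / 3 \<and>
     connected (part1 T) \<and> connected (part2 T) \<and> connected (part3 T) \<and>
     path_image (curve12 T) = frontier (part1 T) \<inter> frontier (part2 T) \<and>
     path_image (curve23 T) = frontier (part2 T) \<inter> frontier (part3 T) \<and>
     path_image (curve13 T) = frontier (part1 T) \<inter> frontier (part3 T) \<and>
     (\<exists>c \<in> interior C.
        pathstart (curve12 T) = c \<and> pathstart (curve23 T) = c \<and> pathstart (curve13 T) = c) \<and>
     pathfinish (curve12 T) \<in> frontier C \<and>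
     pathfinish (curve23 T) \<in> frontier C \<and>
     pathfinish (curve13 T) \<in> frontier C \<and>
     pathfinish (curve12 T) \<noteq> pathfinish (curve23 T) \<and>
     pathfinish (curve23 T) \<noteq> pathfinish (curve13 T) \<and>
     pathfinish (curve12 T) \<noteq> pathfinish (curve13 T)"

definition max_rel_diameter :: "trisection \<Rightarrow> real" where
  "max_rel_diameter T = Max {diameter (part1 T), diameter (part2 T), diameter (part3 T)}"

(* The corners t1, t2, t3 of the triangle T_r(C) arising from some admissible choice of the
   point m; the triangle itself is convex hull {t1, t2, t3}, and tk lies opposite to the edge
   on the k-th line. *)
definition standard_triangle ::
  "complex set \<Rightarrow> complex \<Rightarrow> complex \<Rightarrow> complex \<Rightarrow> complex \<Rightarrow> bool" where
  "standard_triangle C p t1 t2 t3 \<longleftrightarrow>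
     (\<exists>m \<in> frontier C. dist p m = infdist p (frontier C) \<and>
        (let L1 = {z. (z - m) \<bullet> (m - p) = 0}; L2 = rot120 p ` L1; L3 = rot240 p ` L1
         in L2 \<inter> L3 = {t1} \<and> L3 \<inter> L1 = {t2} \<and> L1 \<inter> L2 = {t3}))"

definition angular_sector :: "complex \<Rightarrow> complex \<Rightarrow> complex \<Rightarrow> complex set" where
  "angular_sector p u w = {p + a *\<^sub>R (u - p) + b *\<^sub>R (w - p) | a b. 0 \<le> a \<and> 0 \<le> b}"

(* The segments from p to v1, v2, v3 cut C into its intersections with the three sectors of
   120 degrees at p bounded by the rays through the vk. *)
definition standard_trisection ::
  "complex set \<Rightarrow> complex \<Rightarrow> complex \<Rightarrow> complex \<Rightarrow> complex \<Rightarrow> trisection" where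
  "standard_trisection C p t1 t2 t3 =
     (let v1 = midpoint t2 t3; v2 = midpoint t3 t1; v3 = midpoint t1 t2
      in \<lparr>part1 = C \<inter> angular_sector p v1 v2,
          part2 = C \<inter> angular_sector p v2 v3,
          part3 = C \<inter> angular_sector p v3 v1,
          curve12 = linepath p v2,
          curve23 = linepath p v3,
          curve13 = linepath p v1\<rparr>)"

end

theory Submission imports Defs begin

text \<open>
  Let \<open>r\<close> be the distance from \<open>p\<close> to the boundary of \<open>C\<close>, and \<open>R\<close> the largest distance from \<open>p\<close> to a
  point of \<open>C\<close>. Both sides are compared with \<open>max R (sqrt 3 * r)\<close>.

  The standard trisection is at most this. Each of its pieces lies in a kite: one third of the
  triangle \<open>T\<^sub>r(C)\<close>, with vertices \<open>p\<close>, \<open>v\<^sub>1\<close>, \<open>t\<^sub>3\<close>, \<open>v\<^sub>2\<close>. The short diagonal of the kite has length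
  \<open>sqrt 3 * r\<close> and cuts it into the triangle \<open>p v\<^sub>1 v\<^sub>2\<close> and an equilateral triangle \<open>v\<^sub>1 v\<^sub>2 t\<^sub>3\<close>. A
  distance is a convex function of each endpoint, so it suffices to look at vertices, and there the
  only distances that can exceed \<open>sqrt 3 * r\<close> are those from \<open>p\<close>; these are at most \<open>R\<close>
  (\<open>diameter_sector_le\<close>). That \<open>C\<close> lies in the triangle holds because the support line of \<open>C\<close> at a
  boundary point nearest to \<open>p\<close> must be orthogonal to the radius
  (\<open>inner_le_at_nearest_frontier_point\<close>).

  Every trisection is at least this, as is every cover of \<open>C\<close> by three compact sets. The three
  points of an orbit of the rotation at distance \<open>\<rho>\<close> from \<open>p\<close> have mutual distances \<open>sqrt 3 * \<rho>\<close>. For \<open>\<rho> = R\<close>, either two of them share a piece, or each piece contains one of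
  them, also the piece that contains \<open>p\<close>; in both cases some diameter is at least \<open>R\<close>
  (\<open>dist_centre_le_of_cover\<close>). For \<open>\<rho> = r\<close>, if all diameters were smaller than \<open>sqrt 3 * r\<close>, every
  orbit on the circle of radius \<open>r\<close> would meet every piece in exactly one point. The pieces would
  then split the circle into disjoint closed nonempty sets, and the circle is connected
  (\<open>sqrt3_radius_le_of_circle_cover\<close>).
\<close>

section \<open>The rotation of order three\<close>

lemma cis_120: "cis (2 * pi / 3) = Complex (- 1 / 2) (sqrt 3 / 2)"
  by (simp add: complex_eq_iff cos_120 sin_120)

lemma cis_240: "cis (4 * pi / 3) = cis (2 * pi / 3) * cis (2 * pi / 3)"
  by (simp add: cis_mult)

lemma cis_120_sq: "cis (2 * pi / 3) * cis (2 * pi / 3) = - 1 - cis (2 * pi / 3)"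
  by (simp add: cis_120 complex_eq_iff)

lemma rot240_eq: "rot240 p z = rot120 p (rot120 p z)"
  by (simp add: rot240_def rot120_def cis_240 mult.assoc)

lemma rot120_cubed: "rot120 p (rot120 p (rot120 p z)) = z"
  using cis_120_sq unfolding rot120_def by algebra

lemma dist_centre_rot120: "dist p (rot120 p z) = dist p z"
  by (simp add: rot120_def dist_norm norm_mult norm_minus_commute)

lemma inner_cis_120: "(cis (2 * pi / 3) * x) \<bullet> (cis (2 * pi / 3) * y) = x \<bullet> y"
proof -
  have "(cos (2 * pi / 3))\<^sup>2 + (sin (2 * pi / 3))\<^sup>2 = 1"
    by simp
  then show ?thesis
    unfolding inner_complex_def times_complex.sel cis.sel by algebra
qed

lemma inner_self_cis_120: "u \<bullet> (cis (2 * pi / 3) * u) = - (norm u)\<^sup>2 / 2"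
  by (simp add: cis_120 inner_complex_def cmod_power2)
    (simp add: power2_eq_square algebra_simps)

lemma norm_oblique_sq:
  "(norm (a *\<^sub>R u + b *\<^sub>R (cis (2 * pi / 3) * u)))\<^sup>2 = (a\<^sup>2 - a * b + b\<^sup>2) * (norm u)\<^sup>2"
proof -
  define v where "v = cis (2 * pi / 3) * u"
  have "(norm (a *\<^sub>R u + b *\<^sub>R v))\<^sup>2 = a\<^sup>2 * (u \<bullet> u) + 2 * a * b * (u \<bullet> v) + b\<^sup>2 * (v \<bullet> v)"
    unfolding power2_norm_eq_inner
    by (simp add: inner_left_distrib inner_right_distrib inner_commute [of v u] power2_eq_square
        algebra_simps)
  moreover have "u \<bullet> v = - (norm u)\<^sup>2 / 2" "v \<bullet> v = (norm u)\<^sup>2" "u \<bullet> u = (norm u)\<^sup>2"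
    by (simp_all only: v_def inner_self_cis_120 inner_cis_120 power2_norm_eq_inner)
  ultimately show ?thesis
    unfolding v_def [symmetric] by (simp add: algebra_simps)
qed

lemma dist_rot120_self: "dist z (rot120 p z) = sqrt 3 * dist p z"
proof -
  have "(dist z (rot120 p z))\<^sup>2 = 3 * (dist p z)\<^sup>2"
    using norm_oblique_sq [of 1 "z - p" "- 1"]
    by (simp add: rot120_def dist_norm norm_minus_commute algebra_simps)
  also have "\<dots> = (sqrt 3 * dist p z)\<^sup>2"
    by (simp add: power_mult_distrib)
  finally show ?thesis
    by simp
qed

section \<open>Lower bounds for covers by three sets\<close>

lemma orbit_dist_le_of_common_piece:
  assumes "bounded A" "diameter A \<le> M"
    and "z \<in> A \<and> rot120 p z \<in> A \<or> rot120 p z \<in> A \<and> rot240 p z \<in> A \<or> z \<in> A \<and> rot240 p z \<in> A"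
  shows "sqrt 3 * dist p z \<le> M"
proof -
  have d: "dist z (rot120 p z) = sqrt 3 * dist p z"
      "dist (rot120 p z) (rot240 p z) = sqrt 3 * dist p z"
      "dist z (rot240 p z) = sqrt 3 * dist p z"
    using dist_rot120_self [of z p] dist_rot120_self [of "rot120 p z" p]
      dist_rot120_self [of "rot240 p z" p]
    by (simp_all add: rot240_eq rot120_cubed dist_centre_rot120 dist_commute)
  show ?thesis
    using assms d diameter_bounded_bound [of A] by (metis order_trans)
qed

lemma dist_centre_le_of_cover:
  assumes cov: "{p, z, rot120 p z, rot240 p z} \<subseteq> A \<union> B \<union> D"
    and bdd: "bounded A" "bounded B" "bounded D"
    and dia: "diameter A \<le> M" "diameter B \<le> M" "diameter D \<le> M"
  shows "dist p z \<le> M"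
proof (cases "sqrt 3 * dist p z \<le> M")
  case True
  have "1 * dist p z \<le> sqrt 3 * dist p z"
    by (intro mult_right_mono) auto
  then show ?thesis
    using True by linarith
next
  case False
  have "\<not> (z \<in> X \<and> rot120 p z \<in> X \<or> rot120 p z \<in> X \<and> rot240 p z \<in> X \<or> z \<in> X \<and> rot240 p z \<in> X)"
    if "X \<in> {A, B, D}" for X
    using orbit_dist_le_of_common_piece [of X M z p] False bdd dia that by blast
  then obtain X x where "X \<in> {A, B, D}" "p \<in> X" "x \<in> X" "x \<in> {z, rot120 p z, rot240 p z}"
    using cov by auto
  then have "dist p x \<le> M" "dist p x = dist p z"
    using diameter_bounded_bound [of X p x] bdd dia
    by (auto simp: rot240_eq dist_centre_rot120)
  then show ?thesis by simp
qed

lemma sqrt3_radius_le_of_circle_cover: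
  fixes p :: complex
  assumes "0 < r" and cov: "sphere p r \<subseteq> A \<union> B \<union> D"
    and cpt: "compact A" "compact B" "compact D"
    and dia: "diameter A \<le> M" "diameter B \<le> M" "diameter D \<le> M"
  shows "sqrt 3 * r \<le> M"
proof (rule ccontr)
  assume small: "\<not> sqrt 3 * r \<le> M"
  have orbit_in_sphere: "rot120 p z \<in> sphere p r" "rot240 p z \<in> sphere p r"
    if "z \<in> sphere p r" for z
    using that by (auto simp: rot240_eq dist_centre_rot120)
  have apart: "\<not> (z \<in> X \<and> rot120 p z \<in> X)" "\<not> (rot120 p z \<in> X \<and> rot240 p z \<in> X)"
      "\<not> (z \<in> X \<and> rot240 p z \<in> X)"
    if "z \<in> sphere p r" "X \<in> {A, B, D}" for X z
    using orbit_dist_le_of_common_piece [of X M z p] small dia that compact_imp_bounded cpt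
    by auto
  have split: "sphere p r \<subseteq> A \<union> (B \<union> D)"
    using cov by auto
  \<comment> \<open>A point common to two pieces would leave a single piece for both other points of its orbit.\<close>
  have disjoint: "A \<inter> (B \<union> D) \<inter> sphere p r = {}"
  proof (rule ccontr)
    assume "A \<inter> (B \<union> D) \<inter> sphere p r \<noteq> {}"
    then obtain z where "z \<in> A" "z \<in> B \<or> z \<in> D" and z: "z \<in> sphere p r" by blast
    then show False
      using apart [OF z, of A] apart [OF z, of B] apart [OF z, of D] orbit_in_sphere [OF z] cov
      by auto
  qed
  have "connected (sphere p r)"
    by (rule connected_sphere) simp
  moreover have "closed A" "closed (B \<union> D)"
    using cpt by (auto intro: compact_imp_closed)
  ultimately have dichotomy: "A \<inter> sphere p r = {} \<or> (B \<union> D) \<inter> sphere p r = {}"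
    using split disjoint unfolding connected_closed by blast
  have z: "p + of_real r \<in> sphere p r"
    using \<open>0 < r\<close> by (simp add: dist_norm)
  show False
    using dichotomy z orbit_in_sphere [OF z] cov
      apart [OF z, of A] apart [OF z, of B] apart [OF z, of D]
    by blast
qed

section \<open>The circumscribed triangle\<close>

text \<open>
  The open disc of radius \<open>dist p m\<close> is connected and avoids the frontier, so it cannot leave \<open>C\<close>.
\<close>
lemma cball_subset_of_nearest_frontier_point:
  fixes C :: "complex set"
  assumes "closed C" "p \<in> C" "dist p m = infdist p (frontier C)" "0 < dist p m"
  shows "cball p (dist p m) \<subseteq> C"
proof -
  have "ball p (dist p m) \<inter> frontier C = {}"
    using assms(3) infdist_le [of _ "frontier C" p] by force
  moreover have "p \<in> ball p (dist p m) \<inter> C"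
    using assms by simp
  ultimately have "ball p (dist p m) \<subseteq> C"
    using connected_Int_frontier [of "ball p (dist p m)" C] by fastforce
  then show ?thesis
    using closure_minimal [of "ball p (dist p m)" C] assms by (simp add: closure_ball)
qed

text \<open>
  A support functional \<open>a\<close> of \<open>C\<close> at \<open>m\<close> is also maximal at \<open>m\<close> on the disc about \<open>p\<close> through \<open>m\<close>. This
  is the equality case of the Cauchy-Schwarz inequality, so \<open>a\<close> is a multiple of \<open>m - p\<close>.
\<close>
lemma inner_le_at_nearest_frontier_point:
  fixes C :: "complex set"
  assumes "convex C" "interior C \<noteq> {}" "m \<in> frontier C" and disc: "cball p (dist p m) \<subseteq> C" and "x \<in> C"
  shows "(x - p) \<bullet> (m - p) \<le> (norm (m - p))\<^sup>2"
proof -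
  let ?u = "m - p"
  let ?r = "norm ?u"
  have "m \<in> closure C" "m \<notin> rel_interior C"
    using assms(2,3) by (auto simp: frontier_def rel_interior_nonempty_interior)
  then obtain b where "b \<noteq> 0" and b: "\<And>y. y \<in> closure C \<Longrightarrow> b \<bullet> m \<le> b \<bullet> y"
    using supporting_hyperplane_relative_frontier [OF \<open>convex C\<close>] by metis
  define a where "a = - b"
  have "a \<noteq> 0" and sup: "\<And>y. y \<in> C \<Longrightarrow> a \<bullet> y \<le> a \<bullet> m"
    using \<open>b \<noteq> 0\<close> b closure_subset by (auto simp: a_def)
  have "p + (?r / norm a) *\<^sub>R a \<in> C"
    using disc \<open>a \<noteq> 0\<close> by (intro subsetD [OF disc]) (simp add: dist_norm norm_minus_commute)
  then have "norm a * ?r \<le> a \<bullet> ?u"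
    using sup [of "p + (?r / norm a) *\<^sub>R a"] \<open>a \<noteq> 0\<close>
    by (simp add: inner_right_distrib inner_diff_right flip: power2_norm_eq_inner)
      (simp add: power2_eq_square algebra_simps)
  then have "a \<bullet> ?u = norm a * ?r"
    using norm_cauchy_schwarz [of a ?u] by linarith
  then have "norm a *\<^sub>R ?u = ?r *\<^sub>R a"
    by (simp add: norm_cauchy_schwarz_eq)
  then have "norm a * ((x - m) \<bullet> ?u) = ?r * (a \<bullet> (x - m))"
    by (metis inner_commute inner_scaleR_right)
  also have "\<dots> \<le> 0"
    using sup [OF \<open>x \<in> C\<close>] by (simp add: inner_diff_right mult_nonneg_nonpos)
  finally have "(x - m) \<bullet> ?u \<le> 0"
    using \<open>a \<noteq> 0\<close> by (simp add: mult_le_0_iff)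
  then show ?thesis
    by (simp add: power2_norm_eq_inner inner_diff_left)
qed

text \<open>
  The corners of the triangle are \<open>p - 2 u\<close> and its images under the rotation, so that the midpoints
  of the edges are the orbit of \<open>m\<close>. The case \<open>m = p\<close> is excluded because \<open>L\<close> would be the whole plane
  and the intersections would not be single points.
\<close>
lemma midpoints_of_standard_lines:
  fixes m p :: complex
  defines "u \<equiv> m - p" and "L \<equiv> {z. (z - m) \<bullet> (m - p) = 0}"
  assumes "rot120 p ` L \<inter> rot240 p ` L = {t1}" "rot240 p ` L \<inter> L = {t2}" "L \<inter> rot120 p ` L = {t3}"
  shows "m \<noteq> p" "midpoint t2 t3 = m" "midpoint t3 t1 = rot120 p m" "midpoint t1 t2 = rot240 p m"
proof -
  let ?w = "cis (2 * pi / 3)"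
  show "m \<noteq> p"
  proof
    assume "m = p"
    then have "L = UNIV" by (simp add: L_def)
    then have "UNIV = rot120 p ` L"
      using rot120_cubed by (metis surj_def)
    then have "{t3} = (UNIV :: complex set)"
      using assms(5) \<open>L = UNIV\<close> by auto
    then show False
      by (metis UNIV_I singletonD zero_neq_one)
  qed
  have shift: "p + x - m = x - u" for x
    by (simp add: u_def)
  have in_L: "p + x \<in> L \<longleftrightarrow> x \<bullet> u = (norm u)\<^sup>2" for x
    unfolding L_def mem_Collect_eq shift
    by (simp add: u_def [symmetric] inner_diff_left power2_norm_eq_inner)
  have w: "u \<bullet> (?w * u) = - (norm u)\<^sup>2 / 2" "(?w * u) \<bullet> u = - (norm u)\<^sup>2 / 2"
    using inner_self_cis_120 [of u] by (simp_all add: inner_commute)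
  \<comment> \<open>Each line contains two of the three corners \<open>p - 2 u\<close>, \<open>p - 2 \<omega> u\<close>, \<open>p - 2 \<omega>\<^sup>2 u\<close>; on the first
    line these are the last two, where \<open>- \<omega>\<^sup>2 = 1 + \<omega>\<close>.\<close>
  have double: "(2 * x) \<bullet> y = 2 * (x \<bullet> y)" for x y :: complex
    by (simp add: inner_complex_def algebra_simps)
  have "p - 2 * (?w * u) \<in> L" "p + 2 * (u + ?w * u) \<in> L"
    using in_L [of "- (2 * (?w * u))"] in_L [of "2 * (u + ?w * u)"] w
    by (simp_all add: power2_norm_eq_inner inner_left_distrib double)
  then have "rot120 p (p - 2 * (?w * u)) \<in> rot120 p ` L" "rot120 p (p + 2 * (u + ?w * u)) \<in> rot120 p ` L"
     "rot240 p (p - 2 * (?w * u)) \<in> rot240 p ` L" "rot240 p (p + 2 * (u + ?w * u)) \<in> rot240 p ` L"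
    by blast+
  moreover have "rot120 p (p - 2 * (?w * u)) = p + 2 * (u + ?w * u)"
     "rot120 p (p + 2 * (u + ?w * u)) = p - 2 * u"
     "rot240 p (p - 2 * (?w * u)) = p - 2 * u"
     "rot240 p (p + 2 * (u + ?w * u)) = p - 2 * (?w * u)"
    unfolding rot240_eq rot120_def using cis_120_sq by algebra+
  ultimately have "t1 = p - 2 * u" "t2 = p - 2 * (?w * u)" "t3 = p + 2 * (u + ?w * u)"
    using assms(3-5) \<open>p - 2 * (?w * u) \<in> L\<close> \<open>p + 2 * (u + ?w * u) \<in> L\<close> by auto
  moreover have "m = p + u" by (simp add: u_def)
  ultimately show "midpoint t2 t3 = m" "midpoint t3 t1 = rot120 p m" "midpoint t1 t2 = rot240 p m"
    unfolding midpoint_eq_iff rot240_eq rot120_def using cis_120_sq by algebra+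
qed

section \<open>The diameter of a piece of the standard trisection\<close>

text \<open>
  In the oblique coordinates \<open>(a, b)\<close> with respect to \<open>u\<close> and \<open>\<omega> u\<close>, the squared distance is
  the quadratic form of \<open>norm_oblique_sq\<close>, and the hypotheses describe the kite with vertices
  \<open>(0, 0)\<close>, \<open>(1, 0)\<close>, \<open>(2, 2)\<close>, \<open>(0, 1)\<close>. The bounds are for the distances to the last three.
\<close>
lemma kite_vertex_bounds:
  fixes a b :: real
  assumes "0 \<le> a" "0 \<le> b" "a - b / 2 \<le> 1" "b - a / 2 \<le> 1"
  shows "(1 - a)\<^sup>2 - (1 - a) * (- b) + (- b)\<^sup>2 \<le> 3"
    and "(- a)\<^sup>2 - (- a) * (1 - b) + (1 - b)\<^sup>2 \<le> 3"
    and "1 \<le> a + b \<Longrightarrow> (2 - a)\<^sup>2 - (2 - a) * (2 - b) + (2 - b)\<^sup>2 \<le> 3"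
proof -
  have "a \<le> 2" "b \<le> 2"
    using assms by linarith+
  \<comment> \<open>For fixed \<open>c\<close> the left-hand side is largest at \<open>d = 1 + c / 2\<close>, where it equals
    \<open>3 - 3 / 4 * c * (2 - c)\<close>.\<close>
  have side: "(1 - c)\<^sup>2 - (1 - c) * (- d) + (- d)\<^sup>2 \<le> 3"
    if "0 \<le> c" "0 \<le> d" "c \<le> 2" "d - c / 2 \<le> 1" for c d :: real
  proof -
    have "0 \<le> c * (2 - c)" "0 \<le> (1 + c / 2 - d) * (2 - c / 2 + d)"
      using that by (auto intro!: mult_nonneg_nonneg)
    then show ?thesis
      by (simp add: power2_eq_square field_simps)
  qed
  show "(1 - a)\<^sup>2 - (1 - a) * (- b) + (- b)\<^sup>2 \<le> 3"
    using side [of a b] assms \<open>a \<le> 2\<close> by simp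
  show "(- a)\<^sup>2 - (- a) * (1 - b) + (1 - b)\<^sup>2 \<le> 3"
    using side [of b a] assms \<open>b \<le> 2\<close> by (simp add: algebra_simps)
  show "(2 - a)\<^sup>2 - (2 - a) * (2 - b) + (2 - b)\<^sup>2 \<le> 3" if "1 \<le> a + b"
  proof -
    \<comment> \<open>The point lies in the cone \<open>t / 2 \<le> s \<le> 2 * t\<close>, where \<open>s * t \<ge> 2 / 9 * (s + t)\<^sup>2\<close>; hence the
      left-hand side \<open>(s + t)\<^sup>2 - 3 * s * t\<close> is at most \<open>(s + t)\<^sup>2 / 3\<close>.\<close>
    define s t where "s = 2 - a" and "t = 2 - b"
    have "0 \<le> (2 * s - t) * (2 * t - s)"
      using assms by (intro mult_nonneg_nonneg) (auto simp: s_def t_def)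
    moreover have "(s + t)\<^sup>2 \<le> 3\<^sup>2"
      using that \<open>a \<le> 2\<close> \<open>b \<le> 2\<close> by (intro power_mono) (auto simp: s_def t_def)
    ultimately have "s\<^sup>2 - s * t + t\<^sup>2 \<le> 3"
      by (simp add: power2_eq_square algebra_simps)
    then show ?thesis
      by (simp add: s_def t_def)
  qed
qed

text \<open>
  If the first point lies in the triangle \<open>p v\<^sub>1 v\<^sub>2\<close>, that is \<open>a + b \<le> 1\<close>, its vertices are
  compared with the second point, and the vertex \<open>p\<close> costs \<open>far\<close>. If both points lie beyond the diagonal
  \<open>a + b = 1\<close>, the vertices are \<open>v\<^sub>1\<close>, \<open>v\<^sub>2\<close> and the corner \<open>P 2 2\<close> of the triangle \<open>T\<^sub>r(C)\<close>.
\<close>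
lemma diameter_sector_le:
  fixes C :: "complex set" and m p :: complex
  defines "u \<equiv> m - p" and "w \<equiv> cis (2 * pi / 3)"
  assumes "p \<in> C" and "m \<noteq> p"
    and far: "\<And>x. x \<in> C \<Longrightarrow> dist p x \<le> M" and M: "sqrt 3 * norm u \<le> M"
    and side1: "\<And>x. x \<in> C \<Longrightarrow> (x - p) \<bullet> u \<le> (norm u)\<^sup>2"
    and side2: "\<And>x. x \<in> C \<Longrightarrow> (x - p) \<bullet> (w * u) \<le> (norm u)\<^sup>2"
  shows "diameter (C \<inter> angular_sector p m (rot120 p m)) \<le> M"
proof -
  define P where "P = (\<lambda>a b::real. p + a *\<^sub>R u + b *\<^sub>R (w * u))"
  let ?S = "C \<inter> angular_sector p m (rot120 p m)"
  have "0 \<le> M"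
    using far [OF \<open>p \<in> C\<close>] by simp
  have close: "dist (P a b) (P c d) \<le> M"
    if "(a - c)\<^sup>2 - (a - c) * (b - d) + (b - d)\<^sup>2 \<le> 3" for a b c d
  proof -
    have "P a b - P c d = (a - c) *\<^sub>R u + (b - d) *\<^sub>R (w * u)"
      by (simp add: P_def algebra_simps)
    then have "(dist (P a b) (P c d))\<^sup>2
        = ((a - c)\<^sup>2 - (a - c) * (b - d) + (b - d)\<^sup>2) * (norm u)\<^sup>2"
      using norm_oblique_sq [of "a - c" u "b - d"] by (simp add: dist_norm w_def)
    also have "\<dots> \<le> 3 * (norm u)\<^sup>2"
      using that by (intro mult_right_mono) auto
    also have "\<dots> = (sqrt 3 * norm u)\<^sup>2"
      by (simp add: power_mult_distrib)
    finally have "dist (P a b) (P c d) \<le> sqrt 3 * norm u"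
      by (rule power2_le_imp_le) simp
    then show ?thesis using M by simp
  qed
  have coords: "\<exists>a b. x = P a b \<and> 0 \<le> a \<and> 0 \<le> b \<and> a - b / 2 \<le> 1 \<and> b - a / 2 \<le> 1"
    if "x \<in> ?S" for x
  proof -
    from that obtain a b where ab: "x = P a b" "0 \<le> a" "0 \<le> b" and "x \<in> C"
      by (auto simp: angular_sector_def rot120_def P_def u_def w_def)
    have pos: "(norm u)\<^sup>2 > 0"
      using \<open>m \<noteq> p\<close> by (simp add: u_def)
    have "(x - p) \<bullet> u = (a - b / 2) * (norm u)\<^sup>2" "(x - p) \<bullet> (w * u) = (b - a / 2) * (norm u)\<^sup>2"
      using inner_self_cis_120 [of u] inner_cis_120 [of u u]
      by (simp_all add: ab P_def w_def inner_left_distrib inner_commute power2_norm_eq_inner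
          algebra_simps)
    then have "(a - b / 2) * (norm u)\<^sup>2 \<le> 1 * (norm u)\<^sup>2" "(b - a / 2) * (norm u)\<^sup>2 \<le> 1 * (norm u)\<^sup>2"
      using side1 [OF \<open>x \<in> C\<close>] side2 [OF \<open>x \<in> C\<close>] by simp_all
    then have "a - b / 2 \<le> 1" "b - a / 2 \<le> 1"
      using pos mult_le_cancel_right_pos by blast+
    then show ?thesis using ab by blast
  qed
  \<comment> \<open>Discs are convex: if \<open>x\<close> is a convex combination of points that are within \<open>M\<close> of \<open>y\<close>, then so
    is \<open>x\<close>.\<close>
  have hull: "dist y (\<alpha> *\<^sub>R x1 + \<beta> *\<^sub>R x2 + \<gamma> *\<^sub>R x3) \<le> M"
    if "dist y x1 \<le> M" "dist y x2 \<le> M" "dist y x3 \<le> M" "0 \<le> \<alpha>" "0 \<le> \<beta>" "0 \<le> \<gamma>" "\<alpha> + \<beta> + \<gamma> = 1"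
    for y x1 x2 x3 :: complex and \<alpha> \<beta> \<gamma> :: real
  proof -
    have "convex hull {x1, x2, x3} \<subseteq> cball y M"
      using that by (intro hull_minimal) auto
    moreover have "\<alpha> *\<^sub>R x1 + \<beta> *\<^sub>R x2 + \<gamma> *\<^sub>R x3 \<in> convex hull {x1, x2, x3}"
      unfolding convex_hull_3 using that by blast
    ultimately show ?thesis by auto
  qed
  have combine: "\<alpha> *\<^sub>R P a1 b1 + \<beta> *\<^sub>R P a2 b2 + \<gamma> *\<^sub>R P a3 b3
      = P (\<alpha> * a1 + \<beta> * a2 + \<gamma> * a3) (\<alpha> * b1 + \<beta> * b2 + \<gamma> * b3)"
    if "\<alpha> + \<beta> + \<gamma> = 1" for \<alpha> \<beta> \<gamma> a1 b1 a2 b2 a3 b3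
  proof -
    have "p = (\<alpha> + \<beta> + \<gamma>) *\<^sub>R p" using that by simp
    then show ?thesis
      unfolding P_def by (simp add: scaleR_add_left scaleR_add_right algebra_simps)
  qed
  have near: "dist x y \<le> M"
    if x: "x = P a b" "0 \<le> a" "0 \<le> b" "a - b / 2 \<le> 1" "b - a / 2 \<le> 1"
      and y: "y \<in> C" "y = P c d" "0 \<le> c" "0 \<le> d" "c - d / 2 \<le> 1" "d - c / 2 \<le> 1"
      and order: "a + b \<le> 1 \<or> 1 \<le> a + b \<and> 1 \<le> c + d" for x y a b c d
  proof -
    have v1: "dist y (P 1 0) \<le> M" and v2: "dist y (P 0 1) \<le> M"
      using close [of 1 c 0 d] close [of 0 c 1 d] kite_vertex_bounds [OF y(3-6)] y
      by (simp_all add: dist_commute)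
    show ?thesis
    proof (cases "a + b \<le> 1")
      case True
      have "dist y (P 0 0) \<le> M"
        using far [OF y(1)] by (simp add: P_def dist_commute)
      then have "dist y ((1 - a - b) *\<^sub>R P 0 0 + a *\<^sub>R P 1 0 + b *\<^sub>R P 0 1) \<le> M"
        using v1 v2 x True by (intro hull) auto
      then show ?thesis
        using x by (simp add: combine dist_commute)
    next
      case False
      then have "1 \<le> a + b" "1 \<le> c + d" using order by auto
      have v3: "dist y (P 2 2) \<le> M"
        using close [of 2 c 2 d] kite_vertex_bounds(3) [OF y(3-6) \<open>1 \<le> c + d\<close>] y
        by (simp add: dist_commute)
      \<comment> \<open>\<open>g\<close> is the barycentric weight of the corner: \<open>a + b\<close> is 1 at \<open>v\<^sub>1\<close> and \<open>v\<^sub>2\<close> and 4 at the corner.\<close>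
      define g where "g = (a + b - 1) / 3"
      have "dist y ((a - 2 * g) *\<^sub>R P 1 0 + (b - 2 * g) *\<^sub>R P 0 1 + g *\<^sub>R P 2 2) \<le> M"
        using v1 v2 v3 x \<open>1 \<le> a + b\<close> by (intro hull) (auto simp: g_def field_simps)
      moreover have "(a - 2 * g) + (b - 2 * g) + g = 1"
        by (simp add: g_def field_simps)
      ultimately show ?thesis
        using x by (simp add: combine dist_commute)
    qed
  qed
  have "dist x y \<le> M" if "x \<in> ?S" "y \<in> ?S" for x y
  proof -
    obtain a b where x: "x = P a b" "0 \<le> a" "0 \<le> b" "a - b / 2 \<le> 1" "b - a / 2 \<le> 1"
      using coords [OF \<open>x \<in> ?S\<close>] by blast
    obtain c d where y: "y = P c d" "0 \<le> c" "0 \<le> d" "c - d / 2 \<le> 1" "d - c / 2 \<le> 1"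
      using coords [OF \<open>y \<in> ?S\<close>] by blast
    consider "a + b \<le> 1" | "c + d \<le> 1" | "1 \<le> a + b" "1 \<le> c + d" by linarith
    then show ?thesis
      using near [OF x _ y] near [OF y _ x] that by cases (auto simp: dist_commute)
  qed
  then show ?thesis
    using \<open>0 \<le> M\<close> by (intro diameter_le) (auto simp: dist_norm)
qed

section \<open>Minimality of the standard trisection\<close>

theorem theorem3p5:
  fixes C :: "complex set" and p t1 t2 t3 :: complex and T :: trisection
  assumes "planar_convex_body C"
    and "three_rot_symmetric_about C p"
    and "standard_triangle C p t1 t2 t3"
    and "is_trisection C T"
  shows "max_rel_diameter (standard_trisection C p t1 t2 t3) \<le> max_rel_diameter T"
proof -
  define M where "M = max_rel_diameter T"
  let ?w = "cis (2 * pi / 3)"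
  have "compact C" "convex C" "interior C \<noteq> {}" and "p \<in> C" and rot: "rot120 p ` C = C"
    using assms(1,2) by (auto simp: planar_convex_body_def three_rot_symmetric_about_def)
  obtain m where m: "m \<in> frontier C" "dist p m = infdist p (frontier C)"
    and lines: "rot120 p ` {z. (z - m) \<bullet> (m - p) = 0} \<inter> rot240 p ` {z. (z - m) \<bullet> (m - p) = 0} = {t1}"
      "rot240 p ` {z. (z - m) \<bullet> (m - p) = 0} \<inter> {z. (z - m) \<bullet> (m - p) = 0} = {t2}"
      "{z. (z - m) \<bullet> (m - p) = 0} \<inter> rot120 p ` {z. (z - m) \<bullet> (m - p) = 0} = {t3}"
    using assms(3) by (auto simp: standard_triangle_def Let_def dist_commute)
  note mid = midpoints_of_standard_lines [OF lines]
  have disc: "cball p (dist p m) \<subseteq> C"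
    using cball_subset_of_nearest_frontier_point [OF _ \<open>p \<in> C\<close> m(2)] \<open>compact C\<close> mid(1)
    by (auto intro: compact_imp_closed)

  have cover: "C = part1 T \<union> part2 T \<union> part3 T"
    and cpt: "compact (part1 T)" "compact (part2 T)" "compact (part3 T)"
    using assms(4) by (auto simp: is_trisection_def)
  have dia: "diameter (part1 T) \<le> M" "diameter (part2 T) \<le> M" "diameter (part3 T) \<le> M"
    by (auto simp: M_def max_rel_diameter_def)
  have far: "dist p x \<le> M" if "x \<in> C" for x
  proof -
    have "rot120 p x \<in> C" "rot240 p x \<in> C"
      using rot that by (auto simp: rot240_eq)
    then show ?thesis
      using dist_centre_le_of_cover [of p x "part1 T" "part2 T" "part3 T" M] cover \<open>p \<in> C\<close> that
        dia cpt compact_imp_bounded by auto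
  qed
  have "sqrt 3 * dist p m \<le> M"
    using sqrt3_radius_le_of_circle_cover [of "dist p m" p "part1 T" "part2 T" "part3 T" M]
      disc cover mid(1) dia cpt sphere_cball [of p "dist p m"] by (metis order_trans zero_less_dist_iff)
  then have r: "sqrt 3 * norm (m - p) \<le> M"
    by (simp add: dist_norm norm_minus_commute)

  have side: "(x - p) \<bullet> (m - p) \<le> (norm (m - p))\<^sup>2" if "x \<in> C" for x
    using inner_le_at_nearest_frontier_point [OF \<open>convex C\<close> \<open>interior C \<noteq> {}\<close> m(1) disc that] .
  have side_rot: "(x - p) \<bullet> (?w * v) \<le> s"
    if "\<And>y. y \<in> C \<Longrightarrow> (y - p) \<bullet> v \<le> s" "x \<in> C" for x v s
  proof -
    obtain y where "y \<in> C" "x = rot120 p y" using rot \<open>x \<in> C\<close> by blast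
    then show ?thesis using that(1) [of y] by (simp add: rot120_def inner_cis_120)
  qed
  have sides: "(x - p) \<bullet> (?w * (m - p)) \<le> (norm (m - p))\<^sup>2"
      "(x - p) \<bullet> (?w * (?w * (m - p))) \<le> (norm (m - p))\<^sup>2" if "x \<in> C" for x
    using side side_rot that by blast+

  have shift: "rot120 p m - p = ?w * (m - p)" "rot240 p m - p = ?w * (?w * (m - p))"
    "rot120 p (rot240 p m) = m"
    by (simp_all add: rot240_eq rot120_cubed) (simp_all add: rot120_def)
  have "rot120 p m \<noteq> p" "rot240 p m \<noteq> p"
    using mid(1) by (metis dist_centre_rot120 dist_eq_0_iff rot240_eq)+
  have w3: "?w * (?w * (?w * (m - p))) = m - p"
    using cis_120_sq by algebra
  have "diameter (C \<inter> angular_sector p m (rot120 p m)) \<le> M"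
    using diameter_sector_le [OF \<open>p \<in> C\<close> mid(1) far r] side sides by blast
  moreover have "diameter (C \<inter> angular_sector p (rot120 p m) (rot240 p m)) \<le> M"
    using diameter_sector_le [OF \<open>p \<in> C\<close> \<open>rot120 p m \<noteq> p\<close> far] r sides
    by (simp add: shift norm_mult flip: rot240_eq)
  moreover have "diameter (C \<inter> angular_sector p (rot240 p m) m) \<le> M"
    using diameter_sector_le [OF \<open>p \<in> C\<close> \<open>rot240 p m \<noteq> p\<close> far] r sides side
    by (simp add: shift norm_mult w3)
  ultimately show ?thesis
    unfolding M_def [symmetric]
    by (simp add: max_rel_diameter_def standard_trisection_def Let_def mid)
qed

end
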